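(* Let $\mathbb{F}$ be an algebraically closed field of characteristic zero, let $m,n,d,r$ be positive integers, and let $L:\mathrm{Ten}_{n,d}(\mathbb{F})\to\mathrm{Mat}_m(\mathbb{F})$ be an $\mathbb{F}$-linear map such that $\mathrm{rank}(L(\mathbf{u}_1\otimes\cdots\otimes\mathbf{u}_d))\le r$ for all $\mathbf{u}_1,\ldots,\mathbf{u}_d\in\mathbb{F}^n$. Then for every tensor $f\in\mathrm{Ten}_{n,d}(\mathbb{F})$, $$\mathrm{rank}(L(f))\le r\cdot 2^d\cdot n^{\lfloor d/2\rfloor}.$$
   Context: $\mathrm{Ten}_{n,d}(\mathbb{F})=(\mathbb{F}^n)^{\otimes d}$ is the $d$-th tensor power of $\mathbb{F}^n$; $\mathrm{Mat}_m(\mathbb{F})$ is the space of $m\times m$ matrices over $\mathbb{F}$, and $\mathrm{rank}$ on the right side is ordinary matrix rank. *)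

theory Defs
  imports "HOL-Analysis.Analysis"
begin

text \<open>
  The space \<open>Ten\<^bsub>n,d\<^esub>(F) = (F\<^sup>n)\<^sup>\<otimes>\<^sup>d\<close> is modelled by its coordinates in the standard basis:
  with \<open>n = CARD('n)\<close> and \<open>d = CARD('d)\<close>, a tensor is an array indexed by the maps
  \<open>'d \<Rightarrow> 'n\<close>, i.e. by the \<open>d\<close>-tuples of basis indices. The vector space structure is the
  library's, with scalar multiplication \<open>(*s)\<close>. Lemma \<open>tensor_prod_universal\<close> below is the
  universal property of the tensor power for this model.
\<close>

type_synonym ('a, 'n, 'd) tensor = "('a, 'd \<Rightarrow> 'n) vec"

definition tensor_prod :: "('d::finite \<Rightarrow> 'a::comm_monoid_mult ^ 'n::finite) \<Rightarrow> ('a, 'n, 'd) tensor"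
  where "tensor_prod u = (\<chi> \<iota>. \<Prod>k\<in>UNIV. u k $ \<iota> k)"

text \<open>
  The library's \<open>(*s)\<close> takes scalars from the entry type of a vector, so on a matrix, being a
  vector of rows, it does not multiply by field elements.
\<close>

definition mat_scale :: "'a::times \<Rightarrow> 'a ^ 'n ^ 'm \<Rightarrow> 'a ^ 'n ^ 'm"
  where "mat_scale c A = (\<chi> i j. c * A $ i $ j)"

lemma vector_space_mat_scale: "vector_space (mat_scale :: 'a::field \<Rightarrow> 'a ^ 'n ^ 'm \<Rightarrow> _)"
  by unfold_locales (simp_all add: mat_scale_def vec_eq_iff algebra_simps)

lemma tensor_prod_axis:
  "tensor_prod (\<lambda>k::'d::finite. axis (\<iota> k) 1) = (axis \<iota> 1 :: ('a::field, 'n::finite, 'd) tensor)"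
proof -
  have "(\<Prod>k\<in>UNIV. axis (\<iota> k) 1 $ \<kappa> k) = (axis \<iota> 1 $ \<kappa> :: 'a)" for \<kappa>
  proof (cases "\<kappa> = \<iota>")
    case True
    then show ?thesis by (simp add: axis_def)
  next
    case False
    then obtain k where "\<kappa> k \<noteq> \<iota> k" by blast
    then have "\<exists>k\<in>UNIV. axis (\<iota> k) 1 $ \<kappa> k = (0 :: 'a)" by (auto simp: axis_def)
    then have "(\<Prod>k\<in>UNIV. axis (\<iota> k) 1 $ \<kappa> k) = (0 :: 'a)" by (intro prod_zero) auto
    then show ?thesis using False by (auto simp: axis_def)
  qed
  then show ?thesis by (simp add: tensor_prod_def vec_eq_iff)
qed

lemma linear_eq_on_axes:
  fixes f g :: "'a::field ^ 'n::finite \<Rightarrow> 'b::ab_group_add"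
  assumes f: "Vector_Spaces.linear (*s) s f" and g: "Vector_Spaces.linear (*s) s g"
    and eq: "\<And>i. f (axis i 1) = g (axis i 1)"
  shows "f = g"
proof
  fix x
  interpret vector_space_pair "(*s) :: 'a \<Rightarrow> 'a ^ 'n \<Rightarrow> _" s
    using f by (simp add: vector_space_pair_def Vector_Spaces.linear_iff)
  show "f x = g x"
  proof (rule linear_eq_on[OF f g])
    show "x \<in> vec.span cart_basis" by simp
    show "f b = g b" if "b \<in> cart_basis" for b
      using that eq by (auto simp: cart_basis_def)
  qed
qed

lemma multilinear_eq_on_axes:
  fixes \<phi> \<psi> :: "('d::finite \<Rightarrow> 'a::field ^ 'n::finite) \<Rightarrow> 'b::ab_group_add"
  assumes \<phi>: "\<And>u k. Vector_Spaces.linear (*s) s (\<lambda>x. \<phi> (u(k := x)))"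
    and \<psi>: "\<And>u k. Vector_Spaces.linear (*s) s (\<lambda>x. \<psi> (u(k := x)))"
    and eq: "\<And>\<iota>. \<phi> (\<lambda>k. axis (\<iota> k) 1) = \<psi> (\<lambda>k. axis (\<iota> k) 1)"
  shows "\<phi> u = \<psi> u"
proof -
  have "\<forall>u. (\<forall>k. k \<notin> S \<longrightarrow> (\<exists>i. u k = axis i 1)) \<longrightarrow> \<phi> u = \<psi> u" if "finite S" for S
    using that
  proof induction
    case empty
    show ?case
    proof (intro allI impI)
      fix u :: "'d \<Rightarrow> 'a ^ 'n"
      assume "\<forall>k. k \<notin> {} \<longrightarrow> (\<exists>i. u k = axis i 1)"
      then obtain \<iota> where "\<And>k. u k = axis (\<iota> k) 1" by simp metis
      then have "u = (\<lambda>k. axis (\<iota> k) 1)" by auto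
      then show "\<phi> u = \<psi> u" using eq by simp
    qed
  next
    case (insert k S)
    show ?case
    proof (intro allI impI)
      fix u :: "'d \<Rightarrow> 'a ^ 'n"
      assume u: "\<forall>l. l \<notin> insert k S \<longrightarrow> (\<exists>i. u l = axis i 1)"
      have "(\<lambda>x. \<phi> (u(k := x))) = (\<lambda>x. \<psi> (u(k := x)))"
      proof (rule linear_eq_on_axes[OF \<phi> \<psi>])
        fix i
        have "\<forall>l. l \<notin> S \<longrightarrow> (\<exists>j. (u(k := axis i 1)) l = axis j 1)"
          using u by auto
        then show "\<phi> (u(k := axis i 1)) = \<psi> (u(k := axis i 1))" using insert.IH by blast
      qed
      then have "\<phi> (u(k := u k)) = \<psi> (u(k := u k))" by meson
      then show "\<phi> u = \<psi> u" by simp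
    qed
  qed
  from this[of UNIV] show ?thesis by simp
qed

lemma linear_tensor_prod:
  "Vector_Spaces.linear (*s) (*s)
     (\<lambda>x. tensor_prod (u(k := x)) :: ('a::field, 'n::finite, 'd::finite) tensor)"
proof -
  have "tensor_prod (u(k := x)) = (\<chi> \<iota>. x $ \<iota> k * (\<Prod>l\<in>UNIV - {k}. u l $ \<iota> l))" for x :: "'a ^ 'n"
    unfolding tensor_prod_def by (subst prod.remove[of _ k]) (auto simp: vec_eq_iff)
  then show ?thesis
    by (auto simp: Vector_Spaces.linear_iff vec_eq_iff algebra_simps vec.vector_space_axioms)
qed

lemma tensor_prod_universal:
  fixes \<phi> :: "('d::finite \<Rightarrow> 'a::field ^ 'n::finite) \<Rightarrow> 'b::ab_group_add"
  assumes "vector_space (s :: 'a \<Rightarrow> 'b \<Rightarrow> 'b)"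
    and \<phi>: "\<And>u k. Vector_Spaces.linear (*s) s (\<lambda>x. \<phi> (u(k := x)))"
  shows "\<exists>!L. Vector_Spaces.linear (*s) s L \<and>
    (\<forall>u. L (tensor_prod u :: ('a, 'n, 'd) tensor) = \<phi> u)"
proof -
  interpret vector_space s by fact
  define L where "L f = (\<Sum>\<iota>\<in>UNIV. s (f $ \<iota>) (\<phi> (\<lambda>k. axis (\<iota> k) 1)))"
    for f :: "('a, 'n, 'd) tensor"
  have L: "Vector_Spaces.linear (*s) s L"
    by (auto simp: Vector_Spaces.linear_iff L_def vec.vector_space_axioms vector_space_axioms
        scale_left_distrib sum.distrib scale_sum_right)
  have L_axis: "L (axis \<iota> 1) = \<phi> (\<lambda>k. axis (\<iota> k) 1)" for \<iota>
  proof -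
    have "L (axis \<iota> 1) = (\<Sum>\<kappa>\<in>UNIV. if \<kappa> = \<iota> then \<phi> (\<lambda>k. axis (\<iota> k) 1) else 0)"
      unfolding L_def by (rule sum.cong) (auto simp: axis_def)
    then show ?thesis by simp
  qed
  have "L (tensor_prod u) = \<phi> u" for u
  proof (rule multilinear_eq_on_axes[where \<phi> = "\<lambda>u. L (tensor_prod u)" and \<psi> = \<phi>, OF _ \<phi>])
    show "Vector_Spaces.linear (*s) s (\<lambda>x. L (tensor_prod (u(k := x))))" for u k
      using Vector_Spaces.linear_compose[OF linear_tensor_prod L] by (simp add: o_def)
    show "L (tensor_prod (\<lambda>k. axis (\<iota> k) 1)) = \<phi> (\<lambda>k. axis (\<iota> k) 1)" for \<iota>
      by (simp only: tensor_prod_axis L_axis)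
  qed
  moreover have "L' = L" if "Vector_Spaces.linear (*s) s L'" "\<forall>u. L' (tensor_prod u) = \<phi> u" for L'
  proof (rule linear_eq_on_axes[OF that(1) L])
    show "L' (axis \<iota> 1) = L (axis \<iota> 1)" for \<iota>
      using that(2) L_axis[of \<iota>] by (metis tensor_prod_axis)
  qed
  ultimately show ?thesis using L by blast
qed

end

theory Submission
  imports Defs
begin

text \<open>
  Let \<open>M(u) = L(u\<^sub>1 \<otimes> \<dots> \<otimes> u\<^sub>d)\<close>, let \<open>v\<close> be a point where \<open>M\<close> has maximal rank, and let \<open>E\<close> be a
  generalized inverse of \<open>M(v)\<close>, so that \<open>rank E = rank M(v) \<le> r\<close>. Maximality gives a
  factorization \<open>M = M E H\<close> with \<open>H = A\<^sup>-\<^sup>1 M\<close>, \<open>A = 1 - M(v) E + M E\<close>, valid wherever \<open>A\<close> is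
  invertible, in particular near \<open>v\<close>. As \<open>M\<close> is multilinear, \<open>M(x)\<close> is its mixed derivative at
  \<open>v\<close> in the directions \<open>x\<^sub>1, \<dots>, x\<^sub>d\<close>. By the Leibniz rule it is a sum over the \<open>2\<^sup>d\<close> subsets \<open>T\<close>
  of the \<open>d\<close> directions, whose \<open>T\<close>-term is a product \<open>B E C\<close> where \<open>C\<close> depends only on the
  \<open>x\<^sub>k\<close> with \<open>k \<in> T\<close> and \<open>B\<close> only on the others. In \<open>L(f) = \<Sum>\<^sub>\<iota> f\<^sub>\<iota> M(e\<^sub>\<iota>)\<close> the \<open>T\<close>-terms can be grouped by the
  smaller of the two index sets, which leaves at most \<open>n\<close> to the power \<open>d div 2\<close> products of rank \<open>\<le> r\<close>.
\<close>

section \<open>Matrix algebra and rank over a field\<close>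

lemma matrix_mul_diff_left: "((A::'a::ring_1 ^ 'n ^ 'm) - B) ** C = A ** C - B ** C"
  by (simp add: matrix_matrix_mult_def vec_eq_iff left_diff_distrib sum_subtractf)

lemma matrix_mul_diff_right: "(A::'a::ring_1 ^ 'n ^ 'm) ** (B - C) = A ** B - A ** C"
  by (simp add: matrix_matrix_mult_def vec_eq_iff right_diff_distrib sum_subtractf)

lemma matrix_mul_minus_left: "(- (A::'a::ring_1 ^ 'n ^ 'm)) ** B = - (A ** B)"
  by (simp add: matrix_matrix_mult_def vec_eq_iff sum_negf)

lemma matrix_mul_minus_right: "(A::'a::ring_1 ^ 'n ^ 'm) ** (- B) = - (A ** B)"
  by (simp add: matrix_matrix_mult_def vec_eq_iff sum_negf)

lemma matrix_mul_add_left: "((A::'a::semiring_1 ^ 'n ^ 'm) + B) ** C = A ** C + B ** C"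
  by (simp add: matrix_matrix_mult_def vec_eq_iff distrib_right sum.distrib)

lemma matrix_mul_sum_left: "sum F S ** C = (\<Sum>x\<in>S. (F x :: 'a::ring_1 ^ 'n ^ 'm) ** C)"
  by (induction S rule: infinite_finite_induct)
    (simp_all add: matrix_matrix_mult_def vec_eq_iff distrib_right sum.distrib)

lemma matrix_mul_sum_right: "(A :: 'a::ring_1 ^ 'n ^ 'm) ** sum F S = (\<Sum>x\<in>S. A ** F x)"
  by (induction S rule: infinite_finite_induct)
    (simp_all add: matrix_matrix_mult_def vec_eq_iff distrib_left sum.distrib)

lemma mat_scale_mul_left:
  "mat_scale c (A ** B) = mat_scale c (A :: 'a::comm_semiring_1 ^ 'n ^ 'm) ** B"
  by (simp add: mat_scale_def matrix_matrix_mult_def vec_eq_iff sum_distrib_left mult.assoc)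

lemma mat_scale_mul_right:
  "mat_scale c (A ** B) = A ** mat_scale c (B :: 'a::comm_semiring_1 ^ 'n ^ 'm)"
  by (simp add: mat_scale_def matrix_matrix_mult_def vec_eq_iff sum_distrib_left mult.left_commute)

section \<open>Row spaces and rank inequalities\<close>

lemma vector_matrix_mul_linear: "Vector_Spaces.linear (*s) (*s) (\<lambda>x. x v* (A :: 'a::field ^ 'n ^ 'm))"
proof -
  have "(\<lambda>x. x v* A) = (*v) (transpose A)" by (simp add: fun_eq_iff)
  then show ?thesis by (simp only: matrix_vector_mul_linear_gen)
qed

lemma rows_matrix_mul: "rows (A ** B) = (\<lambda>x. x v* (B :: 'a::field ^ 'n ^ 'k)) ` rows A"
proof -
  have "row i (A ** B) = row i A v* B" for i
    by (simp add: row_def matrix_matrix_mult_def vector_matrix_mult_def vec_eq_iff mult.commute)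
  then show ?thesis by (auto simp: rows_def)
qed

lemma vector_matrix_mul_in_span_rows: "x v* (A :: 'a::field ^ 'n ^ 'm) \<in> vec.span (rows A)"
proof -
  have "x v* A = (\<Sum>i\<in>UNIV. x $ i *s row i A)"
    by (simp add: vector_matrix_mult_def row_def vec_eq_iff mult.commute)
  also have "\<dots> \<in> vec.span (rows A)"
    by (intro vec.span_sum vec.span_scale vec.span_base) (auto simp: rows_def)
  finally show ?thesis .
qed

lemma rank_matrix_mul_le_left:
  "rank ((A :: 'a::field ^ 'n ^ 'm) ** (B :: 'a ^ 'k ^ 'n)) \<le> rank A"
  by (simp add: row_rank_def_gen rows_matrix_mul vec.dim_image_le vector_matrix_mul_linear)

lemma rank_matrix_mul_le_right:
  "rank ((A :: 'a::field ^ 'n ^ 'm) ** (B :: 'a ^ 'k ^ 'n)) \<le> rank B"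
  unfolding row_rank_def_gen
  by (rule vec.dim_mono) (auto simp: rows_matrix_mul vector_matrix_mul_in_span_rows)

lemma rank_zero: "rank (0 :: 'a::field ^ 'n ^ 'm) = 0"
  by (auto simp: row_rank_def_gen rows_def row_def vec_eq_iff zero_vec_def)

lemma rank_add_le: "rank (A + B :: 'a::field ^ 'n ^ 'm) \<le> rank A + rank B"
proof -
  obtain C where C: "C \<subseteq> rows A" "vec.independent C" "rows A \<subseteq> vec.span C"
      "card C = vec.dim (rows A)"
    by (rule vec.basis_exists)
  obtain D where D: "D \<subseteq> rows B" "vec.independent D" "rows B \<subseteq> vec.span D"
      "card D = vec.dim (rows B)"
    by (rule vec.basis_exists)
  have fin: "finite C" "finite D" using C D by (auto intro: vec.finiteI_independent)
  have "row i (A + B) \<in> vec.span (C \<union> D)" for i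
  proof -
    have "row i A \<in> vec.span (C \<union> D)" "row i B \<in> vec.span (C \<union> D)"
      using C(3) D(3) vec.span_mono[of C "C \<union> D"] vec.span_mono[of D "C \<union> D"]
      by (auto simp: rows_def)
    then have "row i A + row i B \<in> vec.span (C \<union> D)" by (rule vec.span_add)
    moreover have "row i A + row i B = row i (A + B)"
      by (simp add: row_def vec_eq_iff)
    ultimately show ?thesis by simp
  qed
  then have "vec.dim (rows (A + B)) \<le> card (C \<union> D)"
    using fin by (intro vec.dim_le_card) (auto simp: rows_def)
  also have "\<dots> \<le> card C + card D" by (rule card_Un_le)
  finally show ?thesis using C(4) D(4) by (simp add: row_rank_def_gen)
qed

lemma rank_sum_le:
  "rank (\<Sum>x\<in>S. F x :: 'a::field ^ 'n ^ 'm) \<le> (\<Sum>x\<in>S. rank (F x))"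
proof (induction S rule: infinite_finite_induct)
  case (insert x S)
  then show ?case using rank_add_le[of "F x" "sum F S"] by simp
qed (simp_all add: rank_zero)

text \<open>As \<open>rank A \<le> rank (A ** B)\<close>, the map \<open>\<lambda>x. x v* B\<close>
  is injective on the row space of \<open>A\<close>. It kills the rows of \<open>C ** A\<close>,
  which lie in that space.\<close>

lemma rank_mul_eq_imp_ker_trivial:
  fixes A :: "'a::field ^ 'n ^ 'm" and B :: "'a ^ 'k ^ 'n"
  assumes "rank A \<le> rank (A ** B)" and "C ** A ** B = 0"
  shows "C ** A = (0 :: 'a ^ 'n ^ 'l)"
proof (rule ccontr)
  assume "C ** A \<noteq> 0"
  then obtain i where "row i (C ** A) \<noteq> 0"
    by (auto simp: vec_eq_iff row_def)
  moreover define z where "z = row i (C ** A)"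
  ultimately have z0: "z \<noteq> 0" by simp
  have z: "z \<in> vec.span (rows A)"
  proof -
    have "z \<in> rows (C ** A)" by (auto simp: z_def rows_def)
    then show ?thesis by (auto simp: rows_matrix_mul vector_matrix_mul_in_span_rows)
  qed
  have "z v* B = row i (C ** A ** B)"
    by (simp add: z_def row_def matrix_matrix_mult_def vector_matrix_mult_def vec_eq_iff mult.commute)
  then have zB: "z v* B = 0" using assms(2) by (simp add: row_def vec_eq_iff)
  interpret B: Vector_Spaces.linear "(*s)" "(*s)" "\<lambda>x. x v* B" by (rule vector_matrix_mul_linear)
  have ind: "vec.independent {z}" using z0 by (simp add: vec.dependent_single)
  \<comment> \<open>Extend the nonzero \<open>z\<close> to a basis \<open>D\<close> of the row
    space. As \<open>z v* B = 0\<close>, the images of the other basis vectors span the row space of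
    \<open>A ** B\<close>, which is one vector too few.\<close>
  from z have "{z} \<subseteq> vec.span (rows A)" by simp
  from vec.maximal_independent_subset_extend[OF this ind]
  obtain D where D: "{z} \<subseteq> D" "D \<subseteq> vec.span (rows A)" "vec.independent D"
      "vec.span (rows A) \<subseteq> vec.span D" by blast
  have fin: "finite D" using D(3) by (rule vec.finiteI_independent)
  have cardD: "card D = rank A"
    using vec.dim_eq_card[of D "vec.span (rows A)"] D
    by (metis row_rank_def_gen vec.dim_span vec.span_eq vec.span_span subset_antisym vec.span_mono)
  have "rows (A ** B) \<subseteq> (\<lambda>x. x v* B) ` vec.span D"
    using D(4) vec.span_superset[of "rows A"] by (auto simp: rows_matrix_mul)
  also have "\<dots> = vec.span ((\<lambda>x. x v* B) ` D)" by (simp add: B.span_image)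
  also have "(\<lambda>x. x v* B) ` D = insert 0 ((\<lambda>x. x v* B) ` (D - {z}))"
    using D(1) zB by (auto simp: image_iff)
  finally have "rank (A ** B) \<le> card ((\<lambda>x. x v* B) ` (D - {z}))"
    unfolding row_rank_def_gen using fin by (intro vec.dim_le_card) auto
  also have "\<dots> \<le> card (D - {z})" using fin by (intro card_image_le) auto
  also have "\<dots> < card D" using D(1) fin by (intro psubset_card_mono) auto
  finally show False using cardD assms(1) by simp
qed

lemma ex_generalized_inverse:
  fixes A :: "'a::field ^ 'n ^ 'm"
  obtains E :: "'a ^ 'm ^ 'n" where "A ** E ** A = A" and "E ** A ** E = E"
proof -
  let ?f = "(*v) A"
  obtain g where g: "Vector_Spaces.linear (*s) (*s) g" "\<And>x. ?f (g (?f x)) = ?f x"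
    using vec.linear_exists_right_inverse_on[OF matrix_vector_mul_linear_gen[of A] vec.subspace_UNIV]
    by blast
  define F where "F = matrix g"
  have F: "g = (*v) F"
    using matrix_works[OF g(1)] by (auto simp: F_def)
  have FA: "A ** F ** A = A"
    using g(2) by (simp add: matrix_eq F matrix_vector_mul_assoc[symmetric])
  show ?thesis
  \<comment> \<open>\<open>F\<close> itself may violate the second identity;
    \<open>F ** A ** F\<close> satisfies both.\<close>
  proof (rule that[of "F ** A ** F"])
    show "A ** (F ** A ** F) ** A = A" using FA by (metis matrix_mul_assoc)
    show "F ** A ** F ** A ** (F ** A ** F) = F ** A ** F" using FA by (metis matrix_mul_assoc)
  qed
qed

section \<open>Derivatives at 0 of rational functions\<close>

text \<open>
  The values of \<open>h\<close> at the zeros of the denominator \<open>q\<close> are unconstrained, so junk values of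
  \<open>matrix_inv\<close> at singular matrices are harmless.
\<close>

definition has_rat_deriv :: "('a::field \<Rightarrow> 'a) \<Rightarrow> 'a \<Rightarrow> bool"
  where "has_rat_deriv h h' \<longleftrightarrow> (\<exists>p q. poly q 0 \<noteq> 0 \<and> (\<forall>s. poly q s \<noteq> 0 \<longrightarrow> h s = poly p s / poly q s) \<and>
    h' = (poly (pderiv p) 0 * poly q 0 - poly p 0 * poly (pderiv q) 0) / (poly q 0)\<^sup>2)"

lemma has_rat_deriv_line: "has_rat_deriv (\<lambda>s. a + s * b) b"
  unfolding has_rat_deriv_def
  by (rule exI[of _ "[:a, b:]"], rule exI[of _ 1]) (simp add: pderiv_pCons)

lemma has_rat_deriv_const: "has_rat_deriv (\<lambda>s. a) 0"
  using has_rat_deriv_line[of a 0] by simp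

lemma has_rat_deriv_add:
  assumes "has_rat_deriv f f'" "has_rat_deriv g g'"
  shows "has_rat_deriv (\<lambda>s. f s + g s) (f' + g')"
proof -
  from assms obtain p q u v where pq:
    "poly q 0 \<noteq> 0" "\<forall>s. poly q s \<noteq> 0 \<longrightarrow> f s = poly p s / poly q s"
    "f' = (poly (pderiv p) 0 * poly q 0 - poly p 0 * poly (pderiv q) 0) / (poly q 0)\<^sup>2"
    "poly v 0 \<noteq> 0" "\<forall>s. poly v s \<noteq> 0 \<longrightarrow> g s = poly u s / poly v s"
    "g' = (poly (pderiv u) 0 * poly v 0 - poly u 0 * poly (pderiv v) 0) / (poly v 0)\<^sup>2"
    unfolding has_rat_deriv_def by blast
  show ?thesis
    unfolding has_rat_deriv_def pq(3,6)
    by (rule exI[of _ "p * v + u * q"], rule exI[of _ "q * v"])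
      (simp add: pq(1,2,4,5) pderiv_add pderiv_mult field_simps power2_eq_square)
qed

lemma has_rat_deriv_mult:
  assumes "has_rat_deriv f f'" "has_rat_deriv g g'"
  shows "has_rat_deriv (\<lambda>s. f s * g s) (f' * g 0 + f 0 * g')"
proof -
  from assms obtain p q u v where pq:
    "poly q 0 \<noteq> 0" "\<forall>s. poly q s \<noteq> 0 \<longrightarrow> f s = poly p s / poly q s"
    "f' = (poly (pderiv p) 0 * poly q 0 - poly p 0 * poly (pderiv q) 0) / (poly q 0)\<^sup>2"
    "poly v 0 \<noteq> 0" "\<forall>s. poly v s \<noteq> 0 \<longrightarrow> g s = poly u s / poly v s"
    "g' = (poly (pderiv u) 0 * poly v 0 - poly u 0 * poly (pderiv v) 0) / (poly v 0)\<^sup>2"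
    unfolding has_rat_deriv_def by blast
  show ?thesis
    unfolding has_rat_deriv_def pq(3,6)
    by (rule exI[of _ "p * u"], rule exI[of _ "q * v"])
      (simp add: pq(1,2,4,5) pderiv_add pderiv_mult field_simps power2_eq_square)
qed

lemma has_rat_deriv_diff:
  assumes "has_rat_deriv f f'" "has_rat_deriv g g'"
  shows "has_rat_deriv (\<lambda>s. f s - g s) (f' - g')"
  using has_rat_deriv_add[OF assms(1) has_rat_deriv_mult[OF has_rat_deriv_const[of "-1"] assms(2)]]
  by simp

lemma has_rat_deriv_sum:
  assumes "\<And>x. x \<in> S \<Longrightarrow> has_rat_deriv (f x) (f' x)"
  shows "has_rat_deriv (\<lambda>s. \<Sum>x\<in>S. f x s) (\<Sum>x\<in>S. f' x)"
  using assms
  by (induction S rule: infinite_finite_induct) (auto intro: has_rat_deriv_add has_rat_deriv_const)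

lemma ex_has_rat_deriv_prod:
  assumes "\<And>x. x \<in> S \<Longrightarrow> \<exists>f'. has_rat_deriv (f x) f'"
  shows "\<exists>f'. has_rat_deriv (\<lambda>s. \<Prod>x\<in>S. f x s) f'"
  using assms
proof (induction S rule: infinite_finite_induct)
  case (insert x S)
  then show ?case using has_rat_deriv_mult[of "f x"] by fastforce
qed (auto intro: has_rat_deriv_const)

lemma ex_has_rat_deriv_inverse:
  assumes "has_rat_deriv f f'" "f 0 \<noteq> 0"
  shows "\<exists>g'. has_rat_deriv (\<lambda>s. inverse (f s)) g'"
proof -
  from assms(1) obtain p q where pq:
    "poly q 0 \<noteq> 0" "\<forall>s. poly q s \<noteq> 0 \<longrightarrow> f s = poly p s / poly q s"
    unfolding has_rat_deriv_def by blast
  then have "poly p 0 \<noteq> 0" using assms(2) by auto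
  \<comment> \<open>The extra factor \<open>q\<close> excludes the points where the formula for
    \<open>f\<close> may fail.\<close>
  with pq have "poly (p * q) 0 \<noteq> 0"
    "\<forall>s. poly (p * q) s \<noteq> 0 \<longrightarrow> inverse (f s) = poly (q * q) s / poly (p * q) s"
    by auto
  then show ?thesis unfolding has_rat_deriv_def by blast
qed

text \<open>Expanding the fraction for \<open>f\<close> by the numerator and denominator of
  \<open>c\<close> keeps its derivative at 0 and turns every point with \<open>c s = 0\<close> into
  a zero of the new denominator.\<close>

lemma has_rat_deriv_transform:
  assumes "has_rat_deriv f f'" "has_rat_deriv c c'" "c 0 \<noteq> 0"
    and "\<And>s. c s \<noteq> 0 \<Longrightarrow> g s = f s"
  shows "has_rat_deriv g f'"
proof -
  from assms(1,2) obtain p q u v where pq: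
    "poly q 0 \<noteq> 0" "\<forall>s. poly q s \<noteq> 0 \<longrightarrow> f s = poly p s / poly q s"
    "f' = (poly (pderiv p) 0 * poly q 0 - poly p 0 * poly (pderiv q) 0) / (poly q 0)\<^sup>2"
    "poly v 0 \<noteq> 0" "\<forall>s. poly v s \<noteq> 0 \<longrightarrow> c s = poly u s / poly v s"
    unfolding has_rat_deriv_def by blast
  define w where "w = u * v"
  have w: "poly w 0 \<noteq> 0" "\<And>s. poly w s \<noteq> 0 \<Longrightarrow> g s = f s"
    using pq assms(3,4) by (auto simp: w_def)
  show ?thesis
    unfolding has_rat_deriv_def pq(3)
    by (rule exI[of _ "p * w"], rule exI[of _ "q * w"])
      (simp add: pq(1,2) w pderiv_mult field_simps power2_eq_square)
qed

lemma has_rat_deriv_unique: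
  fixes f :: "'a::field_char_0 \<Rightarrow> 'a"
  assumes "has_rat_deriv f a" "has_rat_deriv f b"
  shows "a = b"
proof -
  have "has_rat_deriv (\<lambda>s. 0) (a - b)"
    using has_rat_deriv_diff[OF assms] by simp
  then obtain p q where pq: "poly q 0 \<noteq> 0" "\<forall>s. poly q s \<noteq> 0 \<longrightarrow> 0 = poly p s / poly q s"
    "a - b = (poly (pderiv p) 0 * poly q 0 - poly p 0 * poly (pderiv q) 0) / (poly q 0)\<^sup>2"
    unfolding has_rat_deriv_def by blast
  \<comment> \<open>\<open>p\<close> vanishes off the zeros of \<open>q\<close>, so
    \<open>p * q\<close> vanishes on the whole field, which is infinite in characteristic
    zero.\<close>
  then have "\<forall>s. poly (p * q) s = 0" by auto
  then have "p * q = 0" using poly_all_0_iff_0 by blast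
  with pq(1) have "p = 0" by auto
  with pq(3) show ?thesis by simp
qed

section \<open>Entrywise derivatives of matrix-valued functions\<close>

definition has_mat_deriv :: "('a::field \<Rightarrow> 'a ^ 'n ^ 'm) \<Rightarrow> 'a ^ 'n ^ 'm \<Rightarrow> bool"
  where "has_mat_deriv F F' \<longleftrightarrow> (\<forall>i j. has_rat_deriv (\<lambda>s. F s $ i $ j) (F' $ i $ j))"

lemma has_mat_deriv_line: "has_mat_deriv (\<lambda>s. A + mat_scale s B) B"
  by (simp add: has_mat_deriv_def mat_scale_def has_rat_deriv_line)

lemma has_mat_deriv_const: "has_mat_deriv (\<lambda>s. A) 0"
  by (simp add: has_mat_deriv_def has_rat_deriv_const)

lemma has_mat_deriv_add:
  "has_mat_deriv F F' \<Longrightarrow> has_mat_deriv G G' \<Longrightarrow> has_mat_deriv (\<lambda>s. F s + G s) (F' + G')"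
  by (simp add: has_mat_deriv_def has_rat_deriv_add)

lemma has_mat_deriv_diff:
  "has_mat_deriv F F' \<Longrightarrow> has_mat_deriv G G' \<Longrightarrow> has_mat_deriv (\<lambda>s. F s - G s) (F' - G')"
  by (simp add: has_mat_deriv_def has_rat_deriv_diff)

lemma has_mat_deriv_sum:
  "(\<And>x. x \<in> S \<Longrightarrow> has_mat_deriv (F x) (F' x)) \<Longrightarrow>
    has_mat_deriv (\<lambda>s. \<Sum>x\<in>S. F x s) (\<Sum>x\<in>S. F' x)"
  by (simp add: has_mat_deriv_def has_rat_deriv_sum)

lemma has_mat_deriv_mult:
  "has_mat_deriv F F' \<Longrightarrow> has_mat_deriv G G' \<Longrightarrow>
    has_mat_deriv (\<lambda>s. F s ** G s) (F' ** G 0 + F 0 ** G')"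
  by (auto simp: has_mat_deriv_def matrix_matrix_mult_def sum.distrib[symmetric]
      intro!: has_rat_deriv_sum has_rat_deriv_mult)

lemma has_mat_deriv_unique:
  "has_mat_deriv F (A :: 'a::field_char_0 ^ 'n ^ 'm) \<Longrightarrow> has_mat_deriv F B \<Longrightarrow> A = B"
  unfolding has_mat_deriv_def vec_eq_iff by (blast intro: has_rat_deriv_unique)

text \<open>The permutation sum is a polynomial in the entries. Existence is enough: determinants
  serve below as cut-off functions and in Cramer's rule.\<close>

lemma ex_has_rat_deriv_det:
  fixes F :: "'a::field \<Rightarrow> 'a ^ 'n ^ 'n"
  assumes "has_mat_deriv F F'"
  obtains f' where "has_rat_deriv (\<lambda>s. det (F s)) f'"
proof -
  have entry: "\<exists>f'. has_rat_deriv (\<lambda>s. F s $ i $ p i) f'" for p :: "'n \<Rightarrow> 'n" and i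
    using assms unfolding has_mat_deriv_def by (intro exI) (elim allE)
  have "\<exists>f'. has_rat_deriv (\<lambda>s. of_int (sign p) * (\<Prod>i\<in>UNIV. F s $ i $ p i)) f'" for p
  proof -
    have "\<exists>f'. has_rat_deriv (\<lambda>s. \<Prod>i\<in>UNIV. F s $ i $ p i) f'"
      by (rule ex_has_rat_deriv_prod) (rule entry)
    then obtain f' where "has_rat_deriv (\<lambda>s. \<Prod>i\<in>UNIV. F s $ i $ p i) f'" ..
    from has_rat_deriv_mult[OF has_rat_deriv_const this] show ?thesis by (rule exI)
  qed
  then obtain D where
    "\<And>p. has_rat_deriv (\<lambda>s. of_int (sign p) * (\<Prod>i\<in>UNIV. F s $ i $ p i)) (D p)" by metis
  then have "has_rat_deriv (\<lambda>s. det (F s)) (\<Sum>p | p permutes UNIV. D p)"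
    unfolding det_def by (rule has_rat_deriv_sum)
  then show ?thesis by (rule that)
qed

lemma matrix_inv_inverse:
  assumes "det (A :: 'a::field ^ 'n ^ 'n) \<noteq> 0"
  shows "A ** matrix_inv A = mat 1" "matrix_inv A ** A = mat 1"
proof -
  have "\<exists>B. A ** B = mat 1 \<and> B ** A = mat 1"
    using assms by (simp add: invertible_det_nz[symmetric] invertible_def)
  from someI_ex[OF this] show "A ** matrix_inv A = mat 1" "matrix_inv A ** A = mat 1"
    by (simp_all add: matrix_inv_def)
qed

text \<open>Serves identities that hold only at invertible matrices; the determinant is the cut-off
  function \<open>c\<close> of \<open>has_rat_deriv_transform\<close>.\<close>

lemma has_mat_deriv_transform_det:
  assumes "has_mat_deriv F F'" "has_mat_deriv C C'" "det (C 0) \<noteq> 0"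
    and "\<And>s. det (C s :: 'a::field ^ 'k ^ 'k) \<noteq> 0 \<Longrightarrow> G s = F s"
  shows "has_mat_deriv G F'"
proof -
  obtain c' where c: "has_rat_deriv (\<lambda>s. det (C s)) c'"
    using assms(2) by (rule ex_has_rat_deriv_det)
  show ?thesis
    unfolding has_mat_deriv_def
  proof (intro allI)
    fix i j
    have "has_rat_deriv (\<lambda>s. F s $ i $ j) (F' $ i $ j)" using assms(1) by (simp add: has_mat_deriv_def)
    then show "has_rat_deriv (\<lambda>s. G s $ i $ j) (F' $ i $ j)"
      using c assms(3) by (rule has_rat_deriv_transform) (simp add: assms(4))
  qed
qed

text \<open>Cramer's rule makes the entries of the inverse rational. The product rule for
  \<open>F s ** matrix_inv (F s)\<close>, which is \<open>mat 1\<close> off the singular points,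
  then determines the derivative.\<close>

lemma has_mat_deriv_matrix_inv:
  fixes F :: "'a::field_char_0 \<Rightarrow> 'a ^ 'n ^ 'n"
  assumes F: "has_mat_deriv F F'" and det: "det (F 0) \<noteq> 0"
  shows "has_mat_deriv (\<lambda>s. matrix_inv (F s)) (- (matrix_inv (F 0) ** F' ** matrix_inv (F 0)))"
proof -
  let ?K = "\<lambda>s. matrix_inv (F s)"
  obtain c' where c: "has_rat_deriv (\<lambda>s. det (F s)) c'"
    using F by (rule ex_has_rat_deriv_det)
  obtain d' where d: "has_rat_deriv (\<lambda>s. inverse (det (F s))) d'"
    using ex_has_rat_deriv_inverse[OF c] det by blast
  have "\<exists>k. has_rat_deriv (\<lambda>s. ?K s $ i $ j) k" for i j
  proof -
    \<comment> \<open>Cramer's numerator for entry \<open>i\<close>, \<open>j\<close> of the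
      inverse: column \<open>i\<close> becomes the \<open>j\<close>-th unit vector.\<close>
    define C where "C s = (\<chi> a b. if b = i then (axis j 1 :: 'a ^ 'n) $ a else F s $ a $ b)" for s
    have "has_mat_deriv C (\<chi> a b. if b = i then 0 else F' $ a $ b)"
      using F by (simp add: C_def has_mat_deriv_def has_rat_deriv_const)
    then obtain e' where "has_rat_deriv (\<lambda>s. det (C s)) e'" by (rule ex_has_rat_deriv_det)
    note * = has_rat_deriv_mult[OF this d]
    have "?K s $ i $ j = det (C s) * inverse (det (F s))" if "det (F s) \<noteq> 0" for s
    proof -
      have "F s *v (?K s *v axis j 1) = axis j 1"
        by (simp add: matrix_vector_mul_assoc matrix_inv_inverse[OF that])
      then have "(?K s *v axis j 1) $ i = det (C s) / det (F s)"
        unfolding cramer[OF that] by (simp add: C_def)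
      moreover have "(?K s *v axis j 1) $ i = ?K s $ i $ j"
        by (simp add: matrix_vector_mult_def axis_def if_distrib cong: if_cong)
      ultimately show ?thesis by (simp add: divide_inverse)
    qed
    then show ?thesis by - (rule exI, rule has_rat_deriv_transform[OF * c det])
  qed
  then obtain k where "\<And>i j. has_rat_deriv (\<lambda>s. ?K s $ i $ j) (k i j)" by metis
  then have K: "has_mat_deriv ?K (\<chi> i j. k i j)" (is "has_mat_deriv _ ?K'")
    by (simp add: has_mat_deriv_def)
  have "has_mat_deriv (\<lambda>s. F s ** ?K s) 0"
    by (rule has_mat_deriv_transform_det[OF has_mat_deriv_const F det]) (rule matrix_inv_inverse)
  then have "F' ** ?K 0 + F 0 ** ?K' = 0"
    using has_mat_deriv_mult[OF F K] has_mat_deriv_unique by blast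
  then have "F 0 ** ?K' = - (F' ** ?K 0)" by (simp add: eq_neg_iff_add_eq_0 add.commute)
  then have "?K 0 ** (F 0 ** ?K') = ?K 0 ** - (F' ** ?K 0)" by simp
  then have "?K' = - (?K 0 ** F' ** ?K 0)"
    by (simp only: matrix_mul_assoc matrix_inv_inverse[OF det] matrix_mul_lid matrix_mul_minus_right)
  with K show ?thesis by simp
qed

section \<open>The Leibniz expansion of a multiaffine matrix of bounded rank\<close>

text \<open>\<open>Q = mat 1 - M0 ** E\<close> is a projection whose kernel is the column space of
  \<open>M0\<close>. Right multiplication by \<open>E\<close> does not lower the rank of
  \<open>M\<close>, so \<open>Q ** K ** M = 0\<close> can be tested after multiplying by
  \<open>E\<close>, where \<open>K ** M ** E = M0 ** E\<close>. The conclusion is equivalent to the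
  factorization \<open>M = M ** E ** (K ** M)\<close>.\<close>

lemma low_rank_generalized_inverse:
  fixes M M0 E :: "'a::field ^ 'm ^ 'm"
  assumes E: "M0 ** E ** M0 = M0" "E ** M0 ** E = E"
    and rank: "rank M \<le> rank M0"
    and det: "det (mat 1 - M0 ** E + M ** E) \<noteq> 0"
  shows "(mat 1 - M0 ** E) ** matrix_inv (mat 1 - M0 ** E + M ** E) ** M = 0"
proof -
  define Q where "Q = mat 1 - M0 ** E"
  define A where "A = Q + M ** E"
  define K where "K = matrix_inv A"
  have K: "K ** A = mat 1"
    using det by (simp add: K_def A_def Q_def matrix_inv_inverse)
  have EQ: "E ** Q = 0"
    by (simp add: Q_def matrix_mul_diff_right matrix_mul_assoc E)
  have QM0E: "Q ** (M0 ** E) = 0"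
    by (simp add: Q_def matrix_mul_diff_left matrix_mul_assoc E)
  have QQ: "Q ** Q = Q"
    by (subst (2) Q_def) (simp add: matrix_mul_diff_right QM0E)
  \<comment> \<open>\<open>A\<close> is the identity on the image of \<open>Q\<close>, because
    \<open>E ** Q = 0\<close>; hence so is its inverse \<open>K\<close>.\<close>
  have "A ** Q = Q"
    by (simp add: A_def matrix_mul_add_left QQ matrix_mul_assoc[symmetric] EQ)
  then have KQ: "K ** Q = Q"
    by (metis K matrix_mul_assoc matrix_mul_lid)
  have "M ** E = A - Q" by (simp add: A_def)
  then have KME: "K ** M ** E = M0 ** E"
    by (simp add: matrix_mul_assoc[symmetric] matrix_mul_diff_right K KQ) (simp add: Q_def)
  have "rank M \<le> rank (M0 ** E ** M0)" using rank E by simp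
  also have "\<dots> \<le> rank (M0 ** E)" by (rule rank_matrix_mul_le_left)
  also have "\<dots> = rank (K ** (M ** E))" using KME by (simp add: matrix_mul_assoc)
  also have "\<dots> \<le> rank (M ** E)" by (rule rank_matrix_mul_le_right)
  finally have "rank M \<le> rank (M ** E)" .
  moreover have "Q ** K ** M ** E = 0"
    using KME QM0E by (metis matrix_mul_assoc)
  ultimately have "Q ** K ** M = 0" by (rule rank_mul_eq_imp_ker_trivial)
  then show ?thesis by (simp add: Q_def K_def A_def)
qed

lemma override_on_insert_line:
  assumes "k \<notin> T"
  shows "override_on (w(k := w k + s *s x k)) x T = (override_on w x T)(k := override_on w x T k + s *s x k)"
    and "(override_on w x T)(k := x k) = override_on w x (insert k T)"
  using assms by (auto simp: override_on_def fun_eq_iff)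

lemma psubsets_insert:
  assumes "k \<notin> S"
  shows "{T. T \<subset> insert k S} = insert S ({T. T \<subset> S} \<union> insert k ` {T. T \<subset> S})"
proof (intro set_eqI iffI)
  fix T assume T: "T \<in> {T. T \<subset> insert k S}"
  show "T \<in> insert S ({T. T \<subset> S} \<union> insert k ` {T. T \<subset> S})"
  proof (cases "k \<in> T")
    case True
    then have "T = insert k (T - {k})" "T - {k} \<subset> S" using T assms by auto
    then show ?thesis by blast
  qed (use T in auto)
qed (use assms in auto)

text \<open>Pairing \<open>T\<close> with \<open>insert k T\<close> matches the two summands of the
  product rule. The summand for \<open>S\<close> will come from differentiating the matrix
  inverse.\<close>

lemma sum_psubsets_insert:
  assumes "k \<notin> S" "finite S"
  shows "(\<Sum>T | T \<subset> insert k S. F T) = F S + (\<Sum>T | T \<subset> S. F T + F (insert k T))"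
proof -
  have fin: "finite {T. T \<subset> S}"
    by (rule finite_subset[of _ "Pow S"]) (use assms in auto)
  have inj: "inj_on (insert k) {T. T \<subset> S}"
    using assms(1) by (auto simp: inj_on_def insert_eq_iff)
  have "{T. T \<subset> S} \<inter> insert k ` {T. T \<subset> S} = {}" "S \<notin> {T. T \<subset> S} \<union> insert k ` {T. T \<subset> S}"
    using assms(1) by auto
  then show ?thesis
    unfolding psubsets_insert[OF assms(1)] using fin inj
    by (simp add: sum.union_disjoint sum.reindex sum.distrib)
qed

text \<open>By \<open>affine\<close>, the slope of \<open>M\<close> along a line in slot
  \<open>k\<close> is the value of \<open>M\<close> with that slot replaced, so mixed derivatives of
  \<open>M\<close> are again values of \<open>M\<close>. \<open>M0\<close> will be a value of
  maximal rank.\<close>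

locale multiaffine_low_rank =
  fixes M :: "('d::finite \<Rightarrow> 'a::field_char_0 ^ 'n) \<Rightarrow> 'a ^ 'm ^ 'm"
    and M0 E :: "'a ^ 'm ^ 'm"
  assumes affine: "M (w(k := w k + s *s y)) = M w + mat_scale s (M (w(k := y)))"
    and gen_inverse: "M0 ** E ** M0 = M0" "E ** M0 ** E = E"
    and rank_le: "rank (M w) \<le> rank M0"
begin

text \<open>This is the identity wherever \<open>M w = M0\<close>.\<close>

definition A :: "('d \<Rightarrow> 'a ^ 'n) \<Rightarrow> 'a ^ 'm ^ 'm"
  where "A w = mat 1 - M0 ** E + M w ** E"

abbreviation D :: "('d \<Rightarrow> 'a ^ 'n) \<Rightarrow> ('d \<Rightarrow> 'a ^ 'n) \<Rightarrow> 'd set \<Rightarrow> 'a ^ 'm ^ 'm"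
  where "D w x S \<equiv> M (override_on w x S)"

text \<open>
  \<open>D w x S\<close> is the mixed derivative of \<open>M\<close> at \<open>w\<close> in the directions \<open>x k\<close>, \<open>k \<in> S\<close>.
  The recursion for \<open>G w x S\<close> is what the Leibniz rule gives for the same mixed derivative of
  \<open>w \<mapsto> matrix_inv (A w) ** M w\<close>.
\<close>

function G :: "('d \<Rightarrow> 'a ^ 'n) \<Rightarrow> ('d \<Rightarrow> 'a ^ 'n) \<Rightarrow> 'd set \<Rightarrow> 'a ^ 'm ^ 'm"
  where "G w x S = matrix_inv (A w) ** (D w x S - (\<Sum>T | T \<subset> S. D w x (S - T) ** E ** G w x T))"
  by pat_completeness auto
termination
  by (relation "Wellfounded.measure (\<lambda>(w, x, S). card S)") (auto intro: psubset_card_mono)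

declare G.simps [simp del]

lemma D_line:
  assumes "k \<notin> T"
  shows "D (w(k := w k + s *s x k)) x T = D w x T + mat_scale s (D w x (insert k T))"
  by (simp only: override_on_insert_line[OF assms] affine)

lemma has_mat_deriv_D:
  "k \<notin> T \<Longrightarrow> has_mat_deriv (\<lambda>s. D (w(k := w k + s *s x k)) x T) (D w x (insert k T))"
  unfolding D_line by (rule has_mat_deriv_line)

lemma has_mat_deriv_A:
  "has_mat_deriv (\<lambda>s. A (w(k := w k + s *s x k))) (D w x {k} ** E)"
proof -
  have "has_mat_deriv (\<lambda>s. M (w(k := w k + s *s x k))) (D w x {k})"
    using has_mat_deriv_D[of k "{}" w x] by simp
  from has_mat_deriv_add[OF has_mat_deriv_const has_mat_deriv_mult[OF this has_mat_deriv_const]]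
  show ?thesis by (simp add: A_def)
qed

text \<open>Differentiating the recursion for \<open>S\<close> in direction \<open>x k\<close>
  yields the recursion for \<open>insert k S\<close>; the proper subsets of \<open>S\<close> are
  covered by induction.\<close>

lemma has_mat_deriv_G:
  assumes "k \<notin> S" "det (A w) \<noteq> 0"
  shows "has_mat_deriv (\<lambda>s. G (w(k := w k + s *s x k)) x S) (G w x (insert k S))"
  using finite[of S] assms(1)
proof (induction S rule: finite_psubset_induct)
  case (psubset S)
  let ?W = "\<lambda>s. w(k := w k + s *s x k)"
  let ?K = "\<lambda>s. matrix_inv (A (?W s))"
  let ?X = "\<lambda>s. D (?W s) x S - (\<Sum>T | T \<subset> S. D (?W s) x (S - T) ** E ** G (?W s) x T)"
  define A1 where "A1 = D w x {k} ** E"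
  define X' where "X' = D w x (insert k S) -
    (\<Sum>T | T \<subset> S. D w x (insert k (S - T)) ** E ** G w x T + D w x (S - T) ** E ** G w x (insert k T))"
  have "has_mat_deriv (\<lambda>s. D (?W s) x (S - T) ** E ** G (?W s) x T)
      (D w x (insert k (S - T)) ** E ** G w x T + D w x (S - T) ** E ** G w x (insert k T))"
    if "T \<subset> S" for T
  proof -
    have "has_mat_deriv (\<lambda>s. D (?W s) x (S - T) ** E) (D w x (insert k (S - T)) ** E)"
      using has_mat_deriv_mult[OF has_mat_deriv_D has_mat_deriv_const, of k "S - T" w x E] psubset.prems
      by simp
    moreover have "has_mat_deriv (\<lambda>s. G (?W s) x T) (G w x (insert k T))"
      using that psubset by blast
    ultimately show ?thesis using has_mat_deriv_mult by fastforce
  qed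
  then have X: "has_mat_deriv ?X X'"
    unfolding X'_def using psubset.prems
    by (intro has_mat_deriv_diff has_mat_deriv_D has_mat_deriv_sum) auto
  have K: "has_mat_deriv ?K (- (matrix_inv (A w) ** A1 ** matrix_inv (A w)))"
    using has_mat_deriv_matrix_inv[OF has_mat_deriv_A[of w k x]] assms(2) by (simp add: A1_def)
  have "has_mat_deriv (\<lambda>s. G (?W s) x S)
     (- (matrix_inv (A w) ** A1 ** matrix_inv (A w)) ** ?X 0 + matrix_inv (A w) ** X')"
    using has_mat_deriv_mult[OF K X] by (subst G.simps) simp
  \<comment> \<open>\<open>matrix_inv (A w) ** ?X 0\<close> is again \<open>G w x S\<close>, so the
    derivative of the inverse contributes exactly the summand \<open>T = S\<close> of the new
    recursion.\<close>
  also have "- (matrix_inv (A w) ** A1 ** matrix_inv (A w)) ** ?X 0 =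
      - (matrix_inv (A w) ** (A1 ** G w x S))"
    by (simp add: matrix_mul_minus_left matrix_mul_assoc[symmetric] G.simps[of w x S])
  also have "\<dots> + matrix_inv (A w) ** X' = matrix_inv (A w) ** (X' - A1 ** G w x S)"
    by (simp add: matrix_mul_diff_right)
  also have "X' - A1 ** G w x S = D w x (insert k S) -
      (\<Sum>T | T \<subset> insert k S. D w x (insert k S - T) ** E ** G w x T)"
  proof -
    have "insert k S - S = {k}" using psubset.prems by auto
    moreover have "insert k S - T = insert k (S - T)" "insert k S - insert k T = S - T"
      if "T \<subset> S" for T using that psubset.prems by auto
    ultimately show ?thesis
      using psubset.prems by (simp add: sum_psubsets_insert X'_def A1_def)
  qed
  also have "matrix_inv (A w) ** \<dots> = G w x (insert k S)" by (simp only: G.simps[of w x "insert k S"])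
  finally show ?case .
qed

text \<open>The empty set is the case of \<open>low_rank_generalized_inverse\<close>. Each further
  direction differentiates an identity that holds on the whole line wherever \<open>A\<close> is
  invertible, which is why \<open>w\<close> stays arbitrary in the induction.\<close>

lemma complement_mul_G:
  "det (A w) \<noteq> 0 \<Longrightarrow> (mat 1 - M0 ** E) ** G w x S = 0"
  using finite[of S]
proof (induction S arbitrary: w rule: finite_induct)
  case empty
  then show ?case
    using low_rank_generalized_inverse[OF gen_inverse rank_le[of w]]
    by (simp add: G.simps[of _ _ "{}"] A_def matrix_mul_assoc)
next
  case (insert k S)
  let ?W = "\<lambda>s. w(k := w k + s *s x k)"
  have "has_mat_deriv (\<lambda>s. (mat 1 - M0 ** E) ** G (?W s) x S)
      ((mat 1 - M0 ** E) ** G w x (insert k S))"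
    using has_mat_deriv_mult[OF has_mat_deriv_const has_mat_deriv_G[OF insert.hyps(2) insert.prems]]
    by simp
  moreover have "has_mat_deriv (\<lambda>s. (mat 1 - M0 ** E) ** G (?W s) x S) 0"
    by (rule has_mat_deriv_transform_det[OF has_mat_deriv_const[of 0] has_mat_deriv_A[of w k x]])
      (simp add: insert.prems, rule insert.IH)
  ultimately show ?case by (rule has_mat_deriv_unique)
qed

lemma Leibniz_expansion:
  assumes "det (A w) \<noteq> 0"
  shows "D w x S = (\<Sum>T\<in>Pow S. D w x (S - T) ** E ** G w x T)"
proof -
  have "A w ** G w x S = D w x S - (\<Sum>T | T \<subset> S. D w x (S - T) ** E ** G w x T)"
    by (subst G.simps) (simp add: matrix_mul_assoc matrix_inv_inverse[OF assms])
  \<comment> \<open>The part \<open>mat 1 - M0 ** E\<close> of \<open>A w\<close> annihilates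
    \<open>G w x S\<close>; what remains is the missing summand \<open>T = S\<close>.\<close>
  moreover have "A w ** G w x S = M w ** E ** G w x S"
    using complement_mul_G[OF assms, of x S] by (simp add: A_def matrix_mul_add_left)
  moreover have "Pow S = insert S {T. T \<subset> S}" by auto
  ultimately show ?thesis by (simp add: algebra_simps)
qed

text \<open>Separates the variables: in the \<open>T\<close>-term of the expansion, the right factor
  sees only the directions in \<open>T\<close>.\<close>

lemma G_cong: "(\<And>k. k \<in> S \<Longrightarrow> x k = y k) \<Longrightarrow> G w x S = G w y S"
  using finite[of S]
proof (induction S rule: finite_psubset_induct)
  case (psubset S)
  have D: "D w x T = D w y T" if "T \<subseteq> S" for T
    using psubset.prems that by (intro arg_cong[of _ _ M]) (auto simp: override_on_def fun_eq_iff)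
  have "G w x T = G w y T" if "T \<subset> S" for T
    using that psubset by blast
  then show ?case
    unfolding G.simps[of w _ S] using D
    by (intro arg_cong2[of _ _ _ _ "(**)"] arg_cong2[of _ _ _ _ "(-)"] sum.cong) auto
qed

end

section \<open>Counting ranks\<close>

lemma mat_scale_sum: "mat_scale c (sum F S) = (\<Sum>x\<in>S. mat_scale c (F x :: 'a::field ^ 'n ^ 'm))"
  by (simp add: mat_scale_def vec_eq_iff sum_distrib_left)

lemma rank_sum_fibres_le:
  fixes F :: "'b::finite \<Rightarrow> 'a::field ^ 'n ^ 'm" and g :: "'b \<Rightarrow> 'c"
  assumes "\<And>y. rank (\<Sum>x | g x = g y. F x) \<le> c"
  shows "rank (\<Sum>x\<in>UNIV. F x) \<le> c * card (range g)"
proof -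
  have "(\<Sum>x\<in>UNIV. F x) = (\<Sum>z\<in>range g. \<Sum>x | g x = z. F x)"
    using sum.group[of UNIV "range g" g F] by simp
  then have "rank (\<Sum>x\<in>UNIV. F x) \<le> (\<Sum>z\<in>range g. rank (\<Sum>x | g x = z. F x))"
    by (simp add: rank_sum_le)
  also have "\<dots> \<le> (\<Sum>z\<in>range g. c)" by (rule sum_mono) (use assms in auto)
  finally show ?thesis by (simp add: mult.commute)
qed

lemma card_range_restrict:
  "card (range (\<lambda>\<iota> :: 'd::finite \<Rightarrow> 'n::finite. restrict \<iota> T)) \<le> CARD('n) ^ card T"
proof -
  have "card (range (\<lambda>\<iota> :: 'd \<Rightarrow> 'n. restrict \<iota> T)) \<le> card (T \<rightarrow>\<^sub>E (UNIV :: 'n set))"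
    by (rule card_mono) (auto intro: finite_PiE)
  then show ?thesis by (simp add: card_PiE)
qed

text \<open>One of \<open>T\<close> and \<open>- T\<close> has at most \<open>CARD('d) div 2\<close>
  elements. Fixing the indices there makes one factor constant, so each fibre sums to a single
  product through \<open>E\<close>.\<close>

lemma rank_sum_product_le:
  fixes a b :: "('d::finite \<Rightarrow> 'n::finite) \<Rightarrow> 'a::field ^ 'm ^ 'm"
  assumes a: "\<And>\<iota> \<kappa>. restrict \<iota> (- T) = restrict \<kappa> (- T) \<Longrightarrow> a \<iota> = a \<kappa>"
    and b: "\<And>\<iota> \<kappa>. restrict \<iota> T = restrict \<kappa> T \<Longrightarrow> b \<iota> = b \<kappa>"
  shows "rank (\<Sum>\<iota>\<in>UNIV. mat_scale (f \<iota>) (a \<iota> ** E ** b \<iota>)) \<le> rank E * CARD('n) ^ (CARD('d) div 2)"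
    (is "rank ?X \<le> _")
proof -
  have pow: "rank ?X \<le> rank E * CARD('n) ^ (CARD('d) div 2)"
    if "rank ?X \<le> rank E * card (range (\<lambda>\<iota> :: 'd \<Rightarrow> 'n. restrict \<iota> U))" "card U \<le> CARD('d) div 2" for U
  proof -
    have "CARD('n) ^ card U \<le> CARD('n) ^ (CARD('d) div 2)"
      using that(2) by (intro power_increasing) (auto simp: Suc_le_eq)
    then have "card (range (\<lambda>\<iota> :: 'd \<Rightarrow> 'n. restrict \<iota> U)) \<le> CARD('n) ^ (CARD('d) div 2)"
      using card_range_restrict order_trans by blast
    then show ?thesis using that(1) by (meson mult_le_mono2 order_trans)
  qed
  have "card T + card (- T) = CARD('d)"
    using card_Un_disjoint[of T "- T"] by simp
  then consider "card T \<le> CARD('d) div 2" | "card (- T) \<le> CARD('d) div 2" by linarith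
  then show ?thesis
  proof cases
    case 1
    have "rank ?X \<le> rank E * card (range (\<lambda>\<iota> :: 'd \<Rightarrow> 'n. restrict \<iota> T))"
    proof (rule rank_sum_fibres_le)
      fix \<kappa> :: "'d \<Rightarrow> 'n"
      \<comment> \<open>On this fibre \<open>b\<close> is constant, and the scalars move into
        \<open>a\<close>.\<close>
      have "(\<Sum>\<iota> | restrict \<iota> T = restrict \<kappa> T. mat_scale (f \<iota>) (a \<iota> ** E ** b \<iota>)) =
          (\<Sum>\<iota> | restrict \<iota> T = restrict \<kappa> T. mat_scale (f \<iota>) (a \<iota>)) ** E ** b \<kappa>"
        unfolding matrix_mul_sum_left
      proof (rule sum.cong)
        fix \<iota> assume "\<iota> \<in> {\<iota>. restrict \<iota> T = restrict \<kappa> T}"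
        then have "b \<iota> = b \<kappa>" by (intro b) simp
        then show "mat_scale (f \<iota>) (a \<iota> ** E ** b \<iota>) = mat_scale (f \<iota>) (a \<iota>) ** E ** b \<kappa>"
          by (simp only: mat_scale_mul_left)
      qed simp
      then show "rank (\<Sum>\<iota> | restrict \<iota> T = restrict \<kappa> T. mat_scale (f \<iota>) (a \<iota> ** E ** b \<iota>)) \<le> rank E"
        by (simp only: order_trans[OF rank_matrix_mul_le_left rank_matrix_mul_le_right])
    qed
    then show ?thesis using 1 by (rule pow)
  next
    case 2
    have "rank ?X \<le> rank E * card (range (\<lambda>\<iota> :: 'd \<Rightarrow> 'n. restrict \<iota> (- T)))"
    proof (rule rank_sum_fibres_le)
      fix \<kappa> :: "'d \<Rightarrow> 'n"
      \<comment> \<open>Here \<open>a\<close> is the constant factor, and the scalars move into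
        \<open>b\<close>.\<close>
      have "(\<Sum>\<iota> | restrict \<iota> (- T) = restrict \<kappa> (- T). mat_scale (f \<iota>) (a \<iota> ** E ** b \<iota>)) =
          a \<kappa> ** E ** (\<Sum>\<iota> | restrict \<iota> (- T) = restrict \<kappa> (- T). mat_scale (f \<iota>) (b \<iota>))"
        unfolding matrix_mul_sum_right
      proof (rule sum.cong)
        fix \<iota> assume "\<iota> \<in> {\<iota>. restrict \<iota> (- T) = restrict \<kappa> (- T)}"
        then have "a \<iota> = a \<kappa>" by (intro a) simp
        then show "mat_scale (f \<iota>) (a \<iota> ** E ** b \<iota>) = a \<kappa> ** E ** mat_scale (f \<iota>) (b \<iota>)"
          by (simp only: mat_scale_mul_right)
      qed simp
      then show "rank (\<Sum>\<iota> | restrict \<iota> (- T) = restrict \<kappa> (- T). mat_scale (f \<iota>) (a \<iota> ** E ** b \<iota>)) \<le> rank E"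
        by (simp only: order_trans[OF rank_matrix_mul_le_left rank_matrix_mul_le_right])
    qed
    then show ?thesis using 2 by (rule pow)
  qed
qed

section \<open>Expansion of \<open>L f\<close> at a point of maximal rank\<close>

theorem mainTheorem2:
  fixes L :: "('a::{alg_closed_field, field_char_0}, 'n::finite, 'd::finite) tensor \<Rightarrow> 'a ^ 'm ^ 'm::finite"
    and r :: nat
  assumes "r > 0"
    and "Vector_Spaces.linear (*s) mat_scale L"
    and "\<And>u :: 'd \<Rightarrow> 'a ^ 'n. rank (L (tensor_prod u)) \<le> r"
  shows "\<forall>f. rank (L f) \<le> r * 2 ^ CARD('d) * CARD('n) ^ (CARD('d) div 2)"
proof
  fix f :: "('a, 'n, 'd) tensor"
  interpret L: Vector_Spaces.linear "(*s)" mat_scale L by fact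
  define M where "M u = L (tensor_prod u)" for u :: "'d \<Rightarrow> 'a ^ 'n"
  \<comment> \<open>The ranks are bounded by \<open>r\<close>, so a maximal one is attained.\<close>
  have "\<exists>k. k \<in> range (\<lambda>w. rank (M w)) \<and> (\<forall>l. l \<in> range (\<lambda>w. rank (M w)) \<longrightarrow> l \<le> k)"
  proof (rule Nat.ex_has_greatest_nat)
    show "rank (M (\<lambda>_. 0)) \<in> range (\<lambda>w. rank (M w))" by (rule rangeI)
    show "\<forall>l. l \<in> range (\<lambda>w. rank (M w)) \<longrightarrow> l \<le> r" using assms(3) by (auto simp: M_def)
  qed
  then obtain v where v: "\<And>w. rank (M w) \<le> rank (M v)" by auto
  obtain E where E: "M v ** E ** M v = M v" "E ** M v ** E = E"
    by (rule ex_generalized_inverse)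
  interpret multiaffine_low_rank M "M v" E
  proof
    fix w :: "'d \<Rightarrow> 'a ^ 'n" and k s y
    interpret T: Vector_Spaces.linear "(*s)" "(*s)"
      "\<lambda>x. tensor_prod (w(k := x)) :: ('a, 'n, 'd) tensor" by (rule linear_tensor_prod)
    show "M (w(k := w k + s *s y)) = M w + mat_scale s (M (w(k := y)))"
      using T.add[of "w k" "s *s y"] T.scale[of s y] by (simp add: M_def L.add L.scale)
  qed (use E v in auto)
  \<comment> \<open>\<open>A v\<close> is the identity, as the two products \<open>M v ** E\<close>
    cancel.\<close>
  have det: "det (A v) \<noteq> 0" by (simp add: A_def)
  have "rank E = rank (E ** M v ** E)" by (simp only: E)
  also have "\<dots> \<le> rank (M v)"
    by (rule order_trans[OF rank_matrix_mul_le_left rank_matrix_mul_le_right])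
  finally have rE: "rank E \<le> r" using assms(3)[of v] by (simp add: M_def)
  \<comment> \<open>Replacing all slots of \<open>v\<close> recovers \<open>M x\<close>, so the
    expansion at the single point \<open>v\<close> is exact for every \<open>x\<close>.\<close>
  have expansion: "M x = (\<Sum>T\<in>UNIV. D v x (- T) ** E ** G v x T)" for x
  proof -
    have "override_on v x UNIV = x" by (simp add: override_on_def)
    then show ?thesis
      using Leibniz_expansion[OF det, of x UNIV] by (simp only: Pow_UNIV Compl_eq_Diff_UNIV)
  qed
  define e where "e \<iota> = (\<lambda>k::'d. axis (\<iota> k) 1 :: 'a ^ 'n)" for \<iota> :: "'d \<Rightarrow> 'n"
  have "L f = L (\<Sum>\<iota>\<in>UNIV. f $ \<iota> *s axis \<iota> 1)" by (simp only: basis_expansion)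
  also have "\<dots> = (\<Sum>\<iota>\<in>UNIV. mat_scale (f $ \<iota>) (M (e \<iota>)))"
    by (simp only: L.sum L.scale M_def e_def tensor_prod_axis)
  also have "\<dots> = (\<Sum>\<iota>\<in>UNIV. \<Sum>T\<in>UNIV. mat_scale (f $ \<iota>) (D v (e \<iota>) (- T) ** E ** G v (e \<iota>) T))"
    by (intro sum.cong refl) (subst expansion, rule mat_scale_sum)
  \<comment> \<open>For fixed \<open>T\<close> the sum over all indices has the form treated by
    \<open>rank_sum_product_le\<close>.\<close>
  also have "\<dots> = (\<Sum>T\<in>UNIV. \<Sum>\<iota>\<in>UNIV. mat_scale (f $ \<iota>) (D v (e \<iota>) (- T) ** E ** G v (e \<iota>) T))"
    by (rule sum.swap)
  finally have "rank (L f) \<le>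
      (\<Sum>T\<in>UNIV. rank (\<Sum>\<iota>\<in>UNIV. mat_scale (f $ \<iota>) (D v (e \<iota>) (- T) ** E ** G v (e \<iota>) T)))"
    by (simp only: rank_sum_le)
  also have "\<dots> \<le> (\<Sum>T\<in>(UNIV :: 'd set set). rank E * CARD('n) ^ (CARD('d) div 2))"
  proof (intro sum_mono rank_sum_product_le)
    fix T and \<iota> \<kappa> :: "'d \<Rightarrow> 'n"
    \<comment> \<open>\<open>e \<iota> k\<close> depends on \<open>\<iota> k\<close> alone, so the
      factors depend only on the restricted indices.\<close>
    have e: "e \<iota> k = e \<kappa> k" if "restrict \<iota> U = restrict \<kappa> U" "k \<in> U" for U k
      using that by (metis e_def restrict_apply')
    show "D v (e \<iota>) (- T) = D v (e \<kappa>) (- T)" if "restrict \<iota> (- T) = restrict \<kappa> (- T)"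
      using e[OF that] by (intro arg_cong[of _ _ M]) (auto simp: override_on_def fun_eq_iff)
    show "G v (e \<iota>) T = G v (e \<kappa>) T" if "restrict \<iota> T = restrict \<kappa> T"
      using e[OF that] by (rule G_cong)
  qed
  also have "\<dots> = rank E * 2 ^ CARD('d) * CARD('n) ^ (CARD('d) div 2)"
    by (simp add: card_UNIV_set)
  also have "\<dots> \<le> r * 2 ^ CARD('d) * CARD('n) ^ (CARD('d) div 2)"
    using rE by (intro mult_le_mono1)
  finally show "rank (L f) \<le> r * 2 ^ CARD('d) * CARD('n) ^ (CARD('d) div 2)" .
qed

end
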